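(* Let $(\widetilde{X},|\cdot|)$ be a uniformly convex normed space and let $A\subseteq \widetilde{X}$ be nonempty. Suppose that $y,p\in \widetilde{X}$ satisfy $d(y,p)\leq d(y,A)$ and $d(p,A)>0$. Let $x\in [p,y)$. Let $\sigma\in (0,\infty)$ be arbitrary. Then $d(x,p)<d(x,A)-r$ for any $r>0$ satisfying $$r\leq\min\left\{\sigma,\ \frac{4d(p,A)}{10},\ d(y,x)\,\delta\left(\frac{d(p,A)}{10(d(x,A)+\sigma+d(y,x))}\right)\right\}.$$
   Context: $d(x,y)=|x-y|$, $d(x,A)=\inf\{d(x,a):a\in A\}$, and $[p,y)=\{p+t(y-p):t\in[0,1)\}$. $(\widetilde X,|\cdot|)$ (real or complex, not necessarily complete) is uniformly convex if for any $\epsilon\in(0,2]$ there is $\delta\in(0,1]$ such that $|x|=|y|=1$ and $|x-y|\ge\epsilon$ imply $|(x+y)/2|\le 1-\delta$. Throughout, $\delta:[0,2]\to[0,1]$ is a fixed increasing (i.e. non-decreasing) function assigning such a value to each $\epsilon$: $\delta(0)=0$, $\delta(\epsilon)>0$ for $\epsilon\in(0,2]$, and $|x|=|y|=1$, $|x-y|\geq\epsilon$ imply $|(x+y)/2|\leq 1-\delta(\epsilon)$. One possible choice is the modulus of convexity $\delta(\epsilon)=\inf\{1-|(x+y)/2|: |x-y|\geq\epsilon,\ |x|=|y|=1\}$. *)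

theory Defs
  imports "HOL-Analysis.Analysis"
begin

text \<open>
  Only real scalars occur in what follows, so a complex normed space enters through its
  underlying real normed space, which has the same norm.  Completeness is not assumed.
\<close>

definition uniformly_convex :: "'a::real_normed_vector itself \<Rightarrow> bool" where
  "uniformly_convex _ \<longleftrightarrow>
    (\<forall>\<epsilon>\<in>{0<..2}. \<exists>d\<in>{0<..1}. \<forall>x y :: 'a.
       norm x = 1 \<longrightarrow> norm y = 1 \<longrightarrow> norm (x - y) \<ge> \<epsilon> \<longrightarrow> norm ((x + y) /\<^sub>R 2) \<le> 1 - d)"

text \<open>
  An admissible function \<open>\<delta> : [0,2] \<rightarrow> [0,1]\<close>, not necessarily the modulus of convexity.
  Its values outside \<open>[0,2]\<close> are unconstrained.
\<close>

definition convexity_function :: "'a::real_normed_vector itself \<Rightarrow> (real \<Rightarrow> real) \<Rightarrow> bool" where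
  "convexity_function _ \<delta> \<longleftrightarrow>
    \<delta> \<in> {0..2} \<rightarrow> {0..1} \<and> mono_on {0..2} \<delta> \<and> \<delta> 0 = 0 \<and>
    (\<forall>\<epsilon>\<in>{0<..2}. \<delta> \<epsilon> > 0 \<and>
       (\<forall>x y :: 'a. norm x = 1 \<longrightarrow> norm y = 1 \<longrightarrow> norm (x - y) \<ge> \<epsilon>
          \<longrightarrow> norm ((x + y) /\<^sub>R 2) \<le> 1 - \<delta> \<epsilon>))"

text \<open>For \<open>p = y\<close> this is \<open>{p}\<close>, unlike \<open>closed_segment p y - {y}\<close>.\<close>

definition half_open_segment :: "'a::real_vector \<Rightarrow> 'a \<Rightarrow> 'a set" where
  "half_open_segment p y = {p + t *\<^sub>R (y - p) | t. t \<in> {0..<1}}"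

end

theory Submission imports Defs begin

text \<open>
  Suppose that \<open>d(x,p) \<ge> d(x,A) - r\<close> and choose \<open>a \<in> A\<close> with \<open>d(x,a) < d(x,A) + r\<close>.  Seen from \<open>y\<close>,
  the points \<open>p\<close> and \<open>a\<close> have nearly equal distances, but \<open>d(p,a) \<ge> d(p,A)\<close>, so their directions differ
  enough for uniform convexity to apply.  Hence the path from \<open>y\<close> to \<open>a\<close> through \<open>x\<close>, which leaves in the
  direction of \<open>p\<close>, is longer than \<open>d(y,a)\<close> by at least \<open>2 d(y,x) \<delta>(\<dots>) \<ge> 2r\<close>.  This contradicts
  \<open>d(y,a) \<ge> d(y,p)\<close>.
\<close>

text \<open>With \<open>M = norm u\<close>, the vector \<open>(M + L) *\<^sub>R u\<close> splits
  into \<open>M *\<^sub>R (u - L *\<^sub>R v)\<close> and a multiple of \<open>v + sgn u\<close>.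
  The hypothesis makes the second part short; dividing by \<open>M\<close> leaves the saving
  \<open>2 * L * d\<close>.\<close>

lemma norm_le_detour:
  fixes u v :: "'a::real_normed_vector"
  assumes "u \<noteq> 0" and "L \<ge> 0" and "norm ((v + sgn u) /\<^sub>R 2) \<le> 1 - d"
  shows "norm u \<le> norm (u - L *\<^sub>R v) + L - 2 * L * d"
proof -
  define M where "M = norm u"
  have M: "M > 0" "M *\<^sub>R sgn u = u"
    using assms(1) by (auto simp: M_def sgn_div_norm)
  have b: "norm (v + sgn u) \<le> 2 * (1 - d)"
    using assms(3) by simp
  have "(M + L) *\<^sub>R u = M *\<^sub>R (u - L *\<^sub>R v) + L *\<^sub>R (M *\<^sub>R v + M *\<^sub>R sgn u)"
    unfolding M(2) by (simp add: algebra_simps)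
  also have "\<dots> = M *\<^sub>R (u - L *\<^sub>R v) + (L * M) *\<^sub>R (v + sgn u)"
    by (simp add: algebra_simps)
  finally have "norm ((M + L) *\<^sub>R u) \<le> norm (M *\<^sub>R (u - L *\<^sub>R v)) + norm ((L * M) *\<^sub>R (v + sgn u))"
    using norm_triangle_ineq by metis
  then have "(M + L) * M \<le> M * norm (u - L *\<^sub>R v) + L * M * norm (v + sgn u)"
    using M(1) assms(2) by (simp add: M_def)
  also have "\<dots> \<le> M * norm (u - L *\<^sub>R v) + L * M * (2 * (1 - d))"
    using b M(1) assms(2) by (intro add_left_mono mult_left_mono) auto
  finally have "M * (M + L) \<le> M * (norm (u - L *\<^sub>R v) + L * (2 * (1 - d)))"
    by (simp add: algebra_simps)
  then have "M + L \<le> norm (u - L *\<^sub>R v) + L * (2 * (1 - d))"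
    using M(1) by simp
  then show ?thesis
    by (simp add: M_def algebra_simps)
qed

lemma infdist_approx:
  fixes A :: "'a::metric_space set"
  assumes "A \<noteq> {}" and "e > 0"
  obtains a where "a \<in> A" and "dist x a < infdist x A + e"
proof -
  have "(INF a\<in>A. dist x a) < infdist x A + e"
    using assms by (simp add: infdist_notempty)
  then show thesis
    using that assms(1) by (subst (asm) cINF_less_iff) auto
qed

text \<open>This turns a distance between two vectors of nearly equal norm into a separation of
  their directions: rescale \<open>sgn w\<close> to the norm of \<open>u\<close>, then correct along
  \<open>sgn w\<close>.\<close>

lemma norm_diff_le_sgn:
  fixes u w :: "'a::real_normed_vector"
  shows "norm (w - u) \<le> norm u * norm (sgn w - sgn u) + \<bar>norm u - norm w\<bar>"
proof -
  have "w - u = norm u *\<^sub>R (sgn w - sgn u) - (norm u - norm w) *\<^sub>R sgn w"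
    by (cases "u = 0"; cases "w = 0") (auto simp: sgn_div_norm algebra_simps)
  then have "norm (w - u) \<le> norm (norm u *\<^sub>R (sgn w - sgn u)) + norm ((norm u - norm w) *\<^sub>R sgn w)"
    using norm_triangle_ineq4 by metis
  also have "\<dots> \<le> norm u * norm (sgn w - sgn u) + \<bar>norm u - norm w\<bar>"
    by (auto simp: norm_sgn)
  finally show ?thesis .
qed

theorem lemma5p5:
  fixes A :: "'a::real_normed_vector set"
    and p x y :: 'a
    and \<delta> :: "real \<Rightarrow> real"
    and \<sigma> r :: real
  assumes "uniformly_convex TYPE('a)"
    and "convexity_function TYPE('a) \<delta>"
    and "A \<noteq> {}"
    and "dist y p \<le> infdist y A"
    and "infdist p A > 0"
    and "x \<in> half_open_segment p y"
    and "\<sigma> > 0"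
    and "r > 0"
    and "r \<le> Min {\<sigma>, 4 * infdist p A / 10,
                  dist y x * \<delta> (infdist p A / (10 * (infdist x A + \<sigma> + dist y x)))}"
  shows "dist x p < infdist x A - r"
proof (rule ccontr)
  define D R s L where "D = infdist p A" and "R = infdist x A" and "s = dist x p" and "L = dist y x"
  define \<epsilon> where "\<epsilon> = D / (10 * (R + \<sigma> + L))"
  assume "\<not> dist x p < infdist x A - r"
  then have sR: "s \<ge> R - r"
    by (simp add: s_def R_def)
  have r: "r \<le> \<sigma>" "r \<le> 4 * D / 10" "r \<le> L * \<delta> \<epsilon>"
    using assms(9) by (auto simp: D_def R_def L_def \<epsilon>_def)
  have D: "D > 0" and R: "R \<ge> 0"
    using assms(5) by (simp_all add: D_def R_def infdist_nonneg)
  \<comment> \<open>If \<open>L = 0\<close>, the third bound on \<open>r\<close> would give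
    \<open>r \<le> 0\<close>. This also rules out \<open>p = y\<close>.\<close>
  have L: "L > 0"
    using r(3) \<open>r > 0\<close> by (cases "L = 0") (auto simp: L_def)
  obtain t where t: "0 \<le> t" "t < 1" "x = p + t *\<^sub>R (y - p)"
    using assms(6) by (auto simp: half_open_segment_def)
  define w where "w = y - p"
  have xp: "x - p = t *\<^sub>R w" and yx: "y - x = (1 - t) *\<^sub>R w"
    by (simp_all add: t(3) w_def algebra_simps)
  have s_eq: "s = t * norm w" and L_eq: "L = (1 - t) * norm w"
    using t(1,2) by (simp_all add: s_def L_def dist_norm xp yx)
  have w: "norm w = s + L"
    by (simp add: s_eq L_eq algebra_simps)
  have "s \<ge> 0"
    by (simp add: s_def)
  then have "w \<noteq> 0"
    using w L by auto
  then have yx': "y - x = L *\<^sub>R sgn w"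
    by (simp add: yx L_eq sgn_div_norm)
  obtain a where a: "a \<in> A" "dist x a < R + r"
    using infdist_approx[OF \<open>A \<noteq> {}\<close> \<open>r > 0\<close>] unfolding R_def by blast
  define u where "u = y - a"
  have M_ge: "norm u \<ge> s + L"
    using assms(4) infdist_le[OF a(1), of y] w by (simp add: u_def w_def dist_norm)
  have u_diff: "u - L *\<^sub>R sgn w = x - a"
    by (simp add: u_def flip: yx')
  have M_less: "norm u < L + R + r"
    using a(2) dist_triangle[of y a x] by (simp add: u_def L_def dist_norm)
  have "u \<noteq> 0"
    using M_ge \<open>s \<ge> 0\<close> L by auto
  have "D \<le> norm (w - u)"
    using infdist_le[OF a(1), of p] by (simp add: D_def u_def w_def dist_norm norm_minus_commute)
  also have "\<dots> \<le> norm u * norm (sgn w - sgn u) + \<bar>norm u - norm w\<bar>"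
    by (rule norm_diff_le_sgn)
  \<comment> \<open>\<open>norm u\<close> lies between \<open>s + L\<close> and
    \<open>L + R + r\<close>, and \<open>R \<le> s + r\<close>.\<close>
  also have "\<bar>norm u - norm w\<bar> \<le> 2 * r"
    using M_ge M_less sR w by linarith
  \<comment> \<open>The bound \<open>r \<le> 4 * D / 10\<close> leaves
    \<open>D - 2 * r \<ge> D / 5\<close>.\<close>
  finally have "D / 10 \<le> norm u * norm (sgn w - sgn u)"
    using r(2) D by linarith
  \<comment> \<open>Replacing \<open>r\<close> by \<open>\<sigma>\<close> keeps the argument of
    \<open>\<delta>\<close> independent of \<open>r\<close>.\<close>
  also have "\<dots> \<le> (R + \<sigma> + L) * norm (sgn w - sgn u)"
    using M_less r(1) by (intro mult_right_mono) auto
  finally have sep: "\<epsilon> \<le> norm (sgn w - sgn u)"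
    using R L \<open>\<sigma> > 0\<close> by (simp add: \<epsilon>_def field_simps)
  have unit: "norm (sgn w) = 1" "norm (sgn u) = 1"
    using \<open>w \<noteq> 0\<close> \<open>u \<noteq> 0\<close> by (simp_all add: norm_sgn)
  \<comment> \<open>Unit vectors are at most 2 apart, so \<open>\<epsilon>\<close> lies in the range
    where \<open>\<delta>\<close> is constrained.\<close>
  have "\<epsilon> \<le> 2"
    using sep norm_triangle_ineq4[of "sgn w" "sgn u"] unit by linarith
  moreover have "\<epsilon> > 0"
    using D R L \<open>\<sigma> > 0\<close> by (simp add: \<epsilon>_def)
  ultimately have "norm ((sgn w + sgn u) /\<^sub>R 2) \<le> 1 - \<delta> \<epsilon>"
    using assms(2) sep unit by (simp add: convexity_function_def)
  then have "norm u \<le> norm (u - L *\<^sub>R sgn w) + L - 2 * L * \<delta> \<epsilon>"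
    using \<open>u \<noteq> 0\<close> L by (intro norm_le_detour) auto
  \<comment> \<open>Since \<open>L * \<delta> \<epsilon> \<ge> r\<close>, the right side is at most
    \<open>R - r + L \<le> s + L \<le> norm u\<close>. The strictness comes from the choice of
    \<open>a\<close>.\<close>
  then have "norm u < R + r + L - 2 * (L * \<delta> \<epsilon>)"
    using a(2) by (simp add: u_diff dist_norm)
  then show False
    using M_ge sR r(3) by linarith
qed

end
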